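(* Let $A,B\in\mathbb{R}^{n\times n}$ with $B\neq 0$, let $b\in\mathbb{R}^n$, and assume that $\{A+B,A-B\}$ has the column $\mathcal{W}$-property. Let $\{z^{(k)}=(\mu^{(k)},x^{(k)})\}_{k\ge 0}$ be the iteration sequence generated by Algorithm NSNA (described in the context), and assume that $\|H(z^{(k)})\|\neq 0$ for all $k\ge 0$. Then any accumulation point $z^*$ of $\{z^{(k)}\}$ satisfies $$H(z^* )=0,$$ i.e., $z^*=(0,x^* )$ and $x^*$ is a solution of the generalized absolute value equation $Ax+B|x|-b=0$.
   Context: Column $\mathcal{W}$-property: for $M,N\in\mathbb{R}^{n\times n}$, a matrix $R\in\mathbb{R}^{n\times n}$ is a column representative of $\{M,N\}$ if for every $j$ the $j$th column of $R$ equals the $j$th column of $M$ or the $j$th column of $N$. The set $\{M,N\}$ has the column $\mathcal{W}$-property if the determinants of all its column representative matrices are all positive or all negative. Notation: $|x|$ is the componentwise absolute value of $x\in\mathbb{R}^n$; $\|\cdot\|$ is the 2-norm; $\mathbb{R}_{++}$ is the set of positive reals. Let $\phi(\mu,t)=\sqrt{\mu^2+t^2}-\mu$ for $(\mu,t)\in\mathbb{R}^2$, $\Phi(\mu,x)=(\phi(\mu,x_1),\dots,\phi(\mu,x_n))^\top$ for $(\mu,x)\in\mathbb{R}\times\mathbb{R}^n$, and for $z=(\mu,x)\in\mathbb{R}\times\mathbb{R}^n$ $$H(z)=\begin{bmatrix}\mu\\ Ax+B\Phi(\mu,x)-b\end{bmatrix}\in\mathbb{R}\times\mathbb{R}^n,\qquad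 \mathcal{M}(z)=\|H(z)\|^2.$$ $H'(z)$ denotes the Jacobian matrix of $H$ at $z$. Algorithm NSNA. Step 1. Choose $\theta,\delta\in(0,1)$ and $z^{(0)}=(\mu^{(0)},x^{(0)})\in\mathbb{R}_{++}\times\mathbb{R}^n$. Let $\mathcal{C}^{(0)}=\mathcal{M}(z^{(0)})$. Choose $\gamma\in(0,1)$ such that $\beta^{(0)}:=\gamma\mathcal{C}^{(0)}<\mu^{(0)}$ and $\gamma\mu^{(0)}<1$. Set $k=0$. Step 2. If $\|H(z^{(k)})\|=0$, stop. Else compute $\Delta z^{(k)}=(\Delta\mu^{(k)},\Delta x^{(k)})\in\mathbb{R}\times\mathbb{R}^n$ by solving $H'(z^{(k)})\Delta z^{(k)}=-H(z^{(k)})+\beta^{(k)}e^{(1)}$, where $e^{(1)}=(1,0)\in\mathbb{R}\times\mathbb{R}^n$. If $\|H(z^{(k)}+\Delta z^{(k)})\|\le\theta\|H(z^{(k)})\|$, set $z^{(k+1)}=z^{(k)}+\Delta z^{(k)}$ and go to Step 4. Otherwise go to Step 3. Step 3. Let $\alpha^{(k)}$ be the maximum of the values $1,\delta,\delta^2,\dots$ such that $\mathcal{M}(z^{(k)}+\alpha^{(k)}\Delta z^{(k)})\le\mathcal{C}^{(k)}-\gamma\|\alpha^{(k)}\Delta z^{(k)}\|^2$. Set $z^{(k+1)}=z^{(k)}+\alpha^{(k)}\Delta z^{(k)}$ and go to Step 4. Step 4. Set $\mathcal{C}^{(k+1)}=\dfrac{(\mathcal{C}^{(k)}+1)\mathcal{M}(z^{(k+1)})}{\mathcal{M}(z^{(k+1)})+1}$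 and $\beta^{(k+1)}=\gamma\,\mathcal{C}^{(k+1)}$. Step 5. Set $k:=k+1$ and go to Step 2. *)

theory Defs
  imports "HOL-Analysis.Analysis"
begin

definition column_representative ::
    "real^'n^'n \<Rightarrow> real^'n^'n \<Rightarrow> real^'n^'n \<Rightarrow> bool" where
  "column_representative M N R \<longleftrightarrow>
     (\<forall>j. column j R = column j M \<or> column j R = column j N)"

definition column_W_property :: "real^'n^'n \<Rightarrow> real^'n^'n \<Rightarrow> bool" where
  "column_W_property M N \<longleftrightarrow>
     (\<forall>R. column_representative M N R \<longrightarrow> det R > 0) \<or>
     (\<forall>R. column_representative M N R \<longrightarrow> det R < 0)"

definition smooth_abs :: "real \<Rightarrow> real \<Rightarrow> real" where
  "smooth_abs \<mu> t = sqrt (\<mu>\<^sup>2 + t\<^sup>2) - \<mu>"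

definition smooth_abs_vec :: "real \<Rightarrow> real^'n \<Rightarrow> real^'n" where
  "smooth_abs_vec \<mu> x = (\<chi> i. smooth_abs \<mu> (x $ i))"

definition gave_map ::
    "real^'n^'n \<Rightarrow> real^'n^'n \<Rightarrow> real^'n \<Rightarrow> real \<times> (real^'n) \<Rightarrow> real \<times> (real^'n)" where
  "gave_map A B b z = (fst z, A *v snd z + B *v smooth_abs_vec (fst z) (snd z) - b)"

text \<open>The norm of the product type is the 2-norm of the concatenated vector.\<close>

definition merit ::
    "real^'n^'n \<Rightarrow> real^'n^'n \<Rightarrow> real^'n \<Rightarrow> real \<times> (real^'n) \<Rightarrow> real" where
  "merit A B b z = (norm (gave_map A B b z))\<^sup>2"

text \<open>
  The Jacobian matrix acts on vectors as the Frechet derivative; the latter is used because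
  the product type has no matrix representation.  \<^term>\<open>frechet_derivative\<close> is unspecified where
  \<^term>\<open>gave_map A B b\<close> is not differentiable, which can happen only for \<open>\<mu> = 0\<close>;
  the iterates below keep \<open>\<mu> > 0\<close> as long as the algorithm has not stopped.
\<close>

definition newton_direction ::
    "real^'n^'n \<Rightarrow> real^'n^'n \<Rightarrow> real^'n \<Rightarrow> real \<Rightarrow> real \<times> (real^'n) \<Rightarrow> real \<times> (real^'n) \<Rightarrow> bool" where
  "newton_direction A B b \<beta> z dz \<longleftrightarrow>
     frechet_derivative (gave_map A B b) (at z) dz = - gave_map A B b z + \<beta> *\<^sub>R (1, 0)"

definition line_search_values ::
    "real^'n^'n \<Rightarrow> real^'n^'n \<Rightarrow> real^'n \<Rightarrow> real \<Rightarrow> real \<Rightarrow> real \<Rightarrow>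
     real \<times> (real^'n) \<Rightarrow> real \<times> (real^'n) \<Rightarrow> real set" where
  "line_search_values A B b \<delta> \<gamma> C z dz =
     {\<alpha>. (\<exists>m::nat. \<alpha> = \<delta> ^ m) \<and>
          merit A B b (z + \<alpha> *\<^sub>R dz) \<le> C - \<gamma> * (norm (\<alpha> *\<^sub>R dz))\<^sup>2}"

text \<open>One pass through the loop, from a point where the stopping test fails.\<close>

definition NSNA_step ::
    "real^'n^'n \<Rightarrow> real^'n^'n \<Rightarrow> real^'n \<Rightarrow> real \<Rightarrow> real \<Rightarrow> real \<Rightarrow>
     real \<times> (real^'n) \<Rightarrow> real \<Rightarrow> real \<Rightarrow> real \<times> (real^'n) \<Rightarrow> real \<Rightarrow> real \<Rightarrow> bool" where
  "NSNA_step A B b \<theta> \<delta> \<gamma> z C \<beta> z' C' \<beta>' \<longleftrightarrow>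
     (\<exists>dz. newton_direction A B b \<beta> z dz \<and>
        (if norm (gave_map A B b (z + dz)) \<le> \<theta> * norm (gave_map A B b z)
         then z' = z + dz
         else (\<exists>\<alpha> \<in> line_search_values A B b \<delta> \<gamma> C z dz.
                 (\<forall>a \<in> line_search_values A B b \<delta> \<gamma> C z dz. a \<le> \<alpha>) \<and>
                 z' = z + \<alpha> *\<^sub>R dz))) \<and>
     C' = (C + 1) * merit A B b z' / (merit A B b z' + 1) \<and>
     \<beta>' = \<gamma> * C'"

text \<open>
  Entries of the sequences after the first zero of the residual are not constrained: the
  algorithm has stopped there.
\<close>

definition NSNA_run ::
    "real^'n^'n \<Rightarrow> real^'n^'n \<Rightarrow> real^'n \<Rightarrow> real \<Rightarrow> real \<Rightarrow> real \<Rightarrow>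
     (nat \<Rightarrow> real \<times> (real^'n)) \<Rightarrow> (nat \<Rightarrow> real) \<Rightarrow> (nat \<Rightarrow> real) \<Rightarrow> bool" where
  "NSNA_run A B b \<theta> \<delta> \<gamma> z C \<beta> \<longleftrightarrow>
     \<theta> \<in> {0<..<1} \<and> \<delta> \<in> {0<..<1} \<and> \<gamma> \<in> {0<..<1} \<and>
     fst (z 0) > 0 \<and> C 0 = merit A B b (z 0) \<and>
     \<beta> 0 = \<gamma> * C 0 \<and> \<beta> 0 < fst (z 0) \<and> \<gamma> * fst (z 0) < 1 \<and>
     (\<forall>k. (\<forall>i\<le>k. norm (gave_map A B b (z i)) \<noteq> 0) \<longrightarrow>
        NSNA_step A B b \<theta> \<delta> \<gamma> (z k) (C k) (\<beta> k) (z (Suc k)) (C (Suc k)) (\<beta> (Suc k)))"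

definition accumulation_point :: "(nat \<Rightarrow> 'a::metric_space) \<Rightarrow> 'a \<Rightarrow> bool" where
  "accumulation_point X l \<longleftrightarrow> (\<exists>r::nat \<Rightarrow> nat. strict_mono r \<and> (X \<circ> r) \<longlonglongrightarrow> l)"

end

theory Submission
  imports Defs
begin

text \<open>
  Along a run, \<open>\<M>(z k) \<le> C k\<close>, the sequence \<open>C\<close> decreases to some \<open>c\<close>, and
  \<open>\<beta> k = \<gamma> C k \<le> \<mu> k\<close>; the recursion for \<open>C\<close> forces \<open>\<M>(z k)\<close> to converge to \<open>c\<close> as well.
  Suppose \<open>c > 0\<close>. Then \<open>\<mu>\<close> stays away from \<open>0\<close>, and by the column W-property the Newton directions
  converge along the subsequence to the Newton direction \<open>v\<close> at the accumulation point \<open>p\<close>.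
  Full steps that shrink the residual by \<open>\<theta>\<close> occur only finitely often, so the line search gives
  \<open>\<alpha> k \<cdot> d k \<longrightarrow> 0\<close>. If \<open>v = 0\<close>, the Newton equation yields \<open>H p = \<gamma> c e1\<close>, so \<open>\<gamma> \<cdot> fst p = 1\<close>,
  against \<open>\<gamma> \<mu> 0 < 1\<close>. Otherwise the step lengths tend to \<open>0\<close>, and the rejected trial steps
  \<open>\<alpha> k / \<delta>\<close> give \<open>0 \<le> H p \<bullet> H' p v = c (\<gamma> \<cdot> fst p - 1) < 0\<close>.
\<close>

section \<open>Determinants with columns between two matrices\<close>

text \<open>Linearity of the determinant in column \<open>j\<close>, obtained from the corresponding
  row rules by transposing.\<close>

lemma det_column_convex_combination:
  fixes P Q R :: "real^'n^'n"
  assumes "column j R = (1 - u) *\<^sub>R column j P + u *\<^sub>R column j Q"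
    and "\<And>i. i \<noteq> j \<Longrightarrow> column i P = column i R"
    and "\<And>i. i \<noteq> j \<Longrightarrow> column i Q = column i R"
  shows "det R = (1 - u) * det P + u * det Q"
proof -
  have tr: "transpose S = (\<chi> i. column i S)" for S :: "real^'n^'n"
    by (simp add: vec_eq_iff transpose_def column_def)
  let ?c = "\<lambda>i. column i R"
  have P: "transpose P = (\<chi> i. if i = j then column j P else ?c i)"
    and Q: "transpose Q = (\<chi> i. if i = j then column j Q else ?c i)"
    using assms(2,3) by (auto simp: tr vec_eq_iff)
  have "transpose R = (\<chi> i. if i = j then (1 - u) *s column j P + u *s column j Q else ?c i)"
    using assms(1) by (auto simp: tr vec_eq_iff algebra_simps)
  then have "det (transpose R) = (1 - u) * det (transpose P) + u * det (transpose Q)"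
    unfolding P Q by (simp only: det_row_add det_row_mul)
  then show ?thesis
    by (simp add: det_transpose)
qed

text \<open>Columns strictly inside their segments are resolved one at a time: each resolution
  writes \<open>det R\<close> as a convex combination of two determinants with fewer such columns.
  The factor \<open>\<sigma>\<close> treats both signs in the W-property at once.\<close>

lemma det_columns_in_segments:
  fixes M N R :: "real^'n^'n"
  assumes rep: "\<And>S. column_representative M N S \<Longrightarrow> \<sigma> * det S > 0"
    and seg: "\<And>j. column j R \<in> closed_segment (column j M) (column j N)"
  shows "\<sigma> * det R > 0"
proof -
  \<comment> \<open>Strengthened for induction: \<open>J\<close> contains every column not yet known
    to be an endpoint.\<close>
  have "\<sigma> * det R > 0"
    if "finite J" "\<And>j. column j R \<in> closed_segment (column j M) (column j N)"
      "\<And>j. j \<notin> J \<Longrightarrow> column j R = column j M \<or> column j R = column j N" for J R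
    using that
  proof (induction J arbitrary: R rule: finite_induct)
    case empty
    then show ?case
      by (intro rep) (auto simp: column_representative_def)
  next
    case (insert j J)
    define repl where "repl v = (\<chi> i k. if k = j then v $ i else R $ i $ k)" for v :: "real^'n"
    have col: "column k (repl v) = (if k = j then v else column k R)" for k v
      by (auto simp: repl_def column_def vec_eq_iff)
    obtain u where u: "0 \<le> u" "u \<le> 1"
      "column j R = (1 - u) *\<^sub>R column j M + u *\<^sub>R column j N"
      using insert.prems(1)[of j] by (auto simp: closed_segment_def)
    have "det R = (1 - u) * det (repl (column j M)) + u * det (repl (column j N))"
      by (rule det_column_convex_combination[where j = j]) (auto simp: col u(3))
    from arg_cong[OF this, of "\<lambda>t. \<sigma> * t"] have eq: "\<sigma> * det R =
        (1 - u) * (\<sigma> * det (repl (column j M))) + u * (\<sigma> * det (repl (column j N)))"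
      by (simp add: algebra_simps)
    have pos: "\<sigma> * det (repl (column j M)) > 0" "\<sigma> * det (repl (column j N)) > 0"
      using insert.prems by (intro insert.IH; auto simp: col)+
    show ?case
    \<comment> \<open>Strict positivity comes from the first summand if \<open>u = 0\<close>,
      otherwise from the second.\<close>
    proof (cases "u = 0")
      case True
      then show ?thesis unfolding eq using pos by simp
    next
      case False
      with u have "0 \<le> 1 - u" "0 < u" by auto
      then show ?thesis
        unfolding eq using pos by (intro add_nonneg_pos mult_nonneg_nonneg[of "1 - u"] mult_pos_pos[of u]) auto
    qed
  qed
  from this[of UNIV R] seg show ?thesis by simp
qed

text \<open>Matrices of this form, with \<open>t j\<close> the quotient of \<open>x $ j\<close> by
  \<open>sqrt (\<mu>\<^sup>2 + (x $ j)\<^sup>2)\<close>, are the x-blocks of the Jacobian.\<close>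

lemma column_W_property_det_nonzero:
  fixes A B :: "real^'n^'n"
  assumes "column_W_property (A + B) (A - B)" and t: "\<And>j. \<bar>t j\<bar> \<le> 1"
  shows "det (\<chi> i j. A $ i $ j + B $ i $ j * t j) \<noteq> 0"
proof -
  let ?R = "\<chi> i j. A $ i $ j + B $ i $ j * t j"
  \<comment> \<open>The weight \<open>u\<close> solves \<open>1 - 2 * u = t j\<close>, since
    \<open>(1 - u) * (a + b) + u * (a - b) = a + (1 - 2 * u) * b\<close>.\<close>
  have seg: "column j ?R \<in> closed_segment (column j (A + B)) (column j (A - B))" for j
    unfolding closed_segment_def
    using t[of j]
    by (auto simp: column_def vec_eq_iff field_simps intro!: exI[of _ "(1 - t j) / 2"])
  obtain \<sigma> :: real where "\<And>S. column_representative (A + B) (A - B) S \<Longrightarrow> \<sigma> * det S > 0"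
    using assms(1) unfolding column_W_property_def
    by (metis mult_1 mult_minus1 neg_0_less_iff_less)
  from det_columns_in_segments[OF this seg] show ?thesis by auto
qed

section \<open>The derivative of the smoothed map\<close>

text \<open>The Jacobian at \<open>z\<close> applied to \<open>v\<close>, written out; it is the
  derivative where \<open>fst z > 0\<close>.\<close>

definition gave_deriv ::
    "real^'n^'n \<Rightarrow> real^'n^'n \<Rightarrow> real \<times> (real^'n) \<Rightarrow> real \<times> (real^'n) \<Rightarrow> real \<times> (real^'n)" where
  "gave_deriv A B z v = (fst v, A *v snd v + B *v (\<chi> i.
     (fst z * fst v + snd z $ i * snd v $ i) / sqrt ((fst z)\<^sup>2 + (snd z $ i)\<^sup>2) - fst v))"

lemma continuous_on_gave_map: "continuous_on S (gave_map A B b)"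
  unfolding gave_map_def smooth_abs_vec_def smooth_abs_def matrix_vector_mult_def
  by (intro continuous_intros)

lemma continuous_on_merit: "continuous_on S (merit A B b)"
  unfolding merit_def by (intro continuous_intros continuous_on_gave_map)

lemma tendsto_gave_map: "(f \<longlongrightarrow> l) F \<Longrightarrow> ((\<lambda>x. gave_map A B b (f x)) \<longlongrightarrow> gave_map A B b l) F"
  by (rule continuous_on_tendsto_compose[OF continuous_on_gave_map[of UNIV]]) auto

lemma tendsto_merit: "(f \<longlongrightarrow> l) F \<Longrightarrow> ((\<lambda>x. merit A B b (f x)) \<longlongrightarrow> merit A B b l) F"
  by (rule continuous_on_tendsto_compose[OF continuous_on_merit[of UNIV]]) auto

lemma sum_power2_pos_left: "a > 0 \<Longrightarrow> a\<^sup>2 + c\<^sup>2 > (0::real)"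
  by (simp add: add_pos_nonneg)

text \<open>Positivity of \<open>fst p\<close> keeps the limiting square roots away from zero. Point
  and direction vary together, as both do along the iteration.\<close>

lemma tendsto_gave_deriv:
  assumes "(f \<longlongrightarrow> p) F" "(g \<longlongrightarrow> v) F" "fst p > 0"
  shows "((\<lambda>x. gave_deriv A B (f x) (g x)) \<longlongrightarrow> gave_deriv A B p v) F"
  unfolding gave_deriv_def matrix_vector_mult_def
  using sum_power2_pos_left[OF assms(3)]
  by (intro tendsto_intros vec_tendstoI tendsto_vec_lambda assms(1,2)) auto

lemma has_derivative_gave_map:
  assumes "fst z > 0"
  shows "(gave_map A B b has_derivative gave_deriv A B z) (at z)"
proof -
  have comp: "((\<lambda>w. smooth_abs (fst w) (snd w $ i)) has_derivative
      (\<lambda>v. (fst z * fst v + snd z $ i * snd v $ i) / sqrt ((fst z)\<^sup>2 + (snd z $ i)\<^sup>2) - fst v)) (at z)" for i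
    unfolding smooth_abs_def
    using real_sqrt_gt_zero[OF sum_power2_pos_left[OF assms, of "snd z $ i"]]
    by (auto intro!: derivative_eq_intros bounded_linear.has_derivative[OF bounded_linear_vec_nth]
        simp: fun_eq_iff field_simps) (simp add: add_divide_distrib)
  have vec: "((\<lambda>w. smooth_abs_vec (fst w) (snd w)) has_derivative
      (\<lambda>v. \<chi> i. (fst z * fst v + snd z $ i * snd v $ i) / sqrt ((fst z)\<^sup>2 + (snd z $ i)\<^sup>2) - fst v)) (at z)"
    unfolding smooth_abs_vec_def
    by (subst has_derivative_componentwise_within) (auto simp: Basis_vec_def inner_axis intro: comp)
  show ?thesis
    unfolding gave_map_def gave_deriv_def
    by (auto intro!: derivative_eq_intros bounded_linear.has_derivative[OF matrix_vector_mul_bounded_linear] vec)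
qed

text \<open>Chain rule for the squared norm; it supplies the slope for the mean value theorem on
  rejected trial steps.\<close>

lemma has_real_derivative_merit_along_line:
  assumes "fst (z + s *\<^sub>R d) > 0"
  shows "((\<lambda>s. merit A B b (z + s *\<^sub>R d)) has_real_derivative
    2 * (gave_map A B b (z + s *\<^sub>R d) \<bullet> gave_deriv A B (z + s *\<^sub>R d) d)) (at s)"
proof -
  let ?w = "z + s *\<^sub>R d"
  have H: "(gave_map A B b has_derivative gave_deriv A B ?w) (at ?w)"
    by (rule has_derivative_gave_map[OF assms])
  have line: "((\<lambda>s. z + s *\<^sub>R d) has_derivative (\<lambda>h. h *\<^sub>R d)) (at s)"
    by (auto intro!: derivative_eq_intros)
  have *: "((\<lambda>s. gave_map A B b (z + s *\<^sub>R d)) has_derivative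
      (\<lambda>h. gave_deriv A B ?w (h *\<^sub>R d))) (at s)"
    using has_derivative_compose[OF line H] .
  have "gave_deriv A B ?w (h *\<^sub>R d) = h *\<^sub>R gave_deriv A B ?w d" for h
    using linear_scale[OF has_derivative_linear[OF H]] .
  then have "((\<lambda>s. gave_map A B b (z + s *\<^sub>R d)) has_vector_derivative gave_deriv A B ?w d) (at s)"
    using * by (simp add: has_vector_derivative_def)
  then show ?thesis
    unfolding merit_def power2_norm_eq_inner has_real_derivative_iff_has_vector_derivative
    by (auto intro!: derivative_eq_intros simp: inner_commute has_vector_derivative_def)
qed

section \<open>The Newton equation and limits of its solutions\<close>

lemma newton_direction_iff:
  assumes "fst z > 0"
  shows "newton_direction A B b \<beta> z d \<longleftrightarrow> gave_deriv A B z d = - gave_map A B b z + \<beta> *\<^sub>R (1, 0)"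
  unfolding newton_direction_def frechet_derivative_at[OF has_derivative_gave_map[OF assms], symmetric] ..

lemma newton_direction_fst:
  assumes "newton_direction A B b \<beta> z d" "fst z > 0"
  shows "fst d = \<beta> - fst z"
  using assms by (simp add: newton_direction_iff gave_deriv_def gave_map_def prod_eq_iff)

text \<open>The first row fixes \<open>fst (d k)\<close>; what remains is a square system with
  nonzero determinant, also at \<open>p\<close>. Cramer's rule then makes \<open>snd (d k)\<close> a
  quotient of determinants with convergent entries.\<close>

lemma newton_directions_converge:
  fixes A B :: "real^'n^'n"
  assumes W: "column_W_property (A + B) (A - B)"
    and p: "fst p > 0" "\<And>k. fst (f k) > 0" "f \<longlonglongrightarrow> p"
    and c: "c \<longlonglongrightarrow> c'"
    and d: "\<And>k. newton_direction A B b (c k) (f k) (d k)"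
  shows "\<exists>v. d \<longlonglongrightarrow> v \<and> gave_deriv A B p v = - gave_map A B b p + c' *\<^sub>R (1, 0)"
proof -
  define r where "r w i = sqrt ((fst w)\<^sup>2 + (snd w $ i)\<^sup>2)" for w :: "real \<times> (real^'n)" and i
  \<comment> \<open>\<open>J\<close> is the x-block of the Jacobian; \<open>rhs\<close> collects the
    residual and the contribution of the known first component \<open>m\<close>.\<close>
  define J where "J w = (\<chi> i j. A $ i $ j + B $ i $ j * (snd w $ j / r w j))" for w
  define rhs where "rhs w m = - snd (gave_map A B b w) - B *v (\<chi> i. fst w * m / r w i - m)" for w m
  have r_nz: "r w i \<noteq> 0" if "fst w > 0" for w i
    using sum_power2_pos_left[OF that, of "snd w $ i"] that by (simp add: r_def)
  have "\<bar>snd w $ j / r w j\<bar> \<le> 1" if "fst w > 0" for w j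
  proof -
    have "\<bar>snd w $ j\<bar> \<le> r w j"
      unfolding r_def by (metis real_sqrt_abs real_sqrt_le_iff le_add_same_cancel2 zero_le_power2)
    moreover have "r w j \<ge> 0"
      by (simp add: r_def)
    ultimately show ?thesis
      using r_nz[OF that, of j] by (simp add: abs_divide divide_le_eq_1)
  qed
  then have det: "det (J w) \<noteq> 0" if "fst w > 0" for w
    unfolding J_def using column_W_property_det_nonzero[OF W, of "\<lambda>j. snd w $ j / r w j"] that by simp
  have fst_d: "fst (d k) = c k - fst (f k)" for k
    using newton_direction_fst[OF d p(2)] .
  have "J (f k) *v snd (d k) = rhs (f k) (fst (d k))" for k
  proof -
    let ?w = "f k"
    have "snd (gave_deriv A B ?w (d k)) = - snd (gave_map A B b ?w)"
      using d[of k] p(2)[of k] by (simp add: newton_direction_iff)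
    moreover have "snd (gave_deriv A B ?w (d k)) =
        J ?w *v snd (d k) + B *v (\<chi> i. fst ?w * fst (d k) / r ?w i - fst (d k))"
      unfolding gave_deriv_def J_def r_def matrix_vector_mult_def
      by (simp add: vec_eq_iff sum.distrib[symmetric] algebra_simps add_divide_distrib)
    ultimately show ?thesis
      by (simp add: rhs_def algebra_simps)
  qed
  then have snd_d: "snd (d k) =
      (\<chi> l. det (\<chi> i j. if j = l then rhs (f k) (fst (d k)) $ i else J (f k) $ i $ j) / det (J (f k)))" for k
    using cramer[OF det[OF p(2)]] by blast
  have fst_lim: "(\<lambda>k. fst (d k)) \<longlonglongrightarrow> c' - fst p"
    unfolding fst_d by (intro tendsto_intros c p)
  have r_lim: "(\<lambda>k. r (f k) i) \<longlonglongrightarrow> r p i" for i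
    unfolding r_def by (intro tendsto_intros p)
  have J_lim: "(\<lambda>k. J (f k) $ i $ j) \<longlonglongrightarrow> J p $ i $ j" for i j
    unfolding J_def vec_lambda_beta by (intro tendsto_intros p r_lim r_nz)
  have rhs_lim: "(\<lambda>k. rhs (f k) (fst (d k)) $ i) \<longlonglongrightarrow> rhs p (c' - fst p) $ i" for i
    unfolding rhs_def matrix_vector_mult_def
    by (intro tendsto_intros p r_lim r_nz fst_lim tendsto_gave_map)
  have det_lim: "(\<lambda>k. det (S k)) \<longlonglongrightarrow> det T" if "\<And>i j. (\<lambda>k. S k $ i $ j) \<longlonglongrightarrow> T $ i $ j"
    for S :: "nat \<Rightarrow> real^'n^'n" and T
    unfolding det_def by (intro tendsto_intros that)
  obtain x where "(\<lambda>k. snd (d k)) \<longlonglongrightarrow> x"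
  proof
    show "(\<lambda>k. snd (d k)) \<longlonglongrightarrow>
      (\<chi> l. det (\<chi> i j. if j = l then rhs p (c' - fst p) $ i else J p $ i $ j) / det (J p))"
      unfolding snd_d
      by (intro tendsto_vec_lambda tendsto_divide det_lim det p) (auto intro: J_lim rhs_lim)
  qed
  then have "(\<lambda>k. (fst (d k), snd (d k))) \<longlonglongrightarrow> (c' - fst p, x)"
    by (intro tendsto_Pair fst_lim)
  then have d_lim: "d \<longlonglongrightarrow> (c' - fst p, x)"
    by simp
  have "(\<lambda>k. gave_deriv A B (f k) (d k)) \<longlonglongrightarrow> gave_deriv A B p (c' - fst p, x)"
    by (intro tendsto_gave_deriv p d_lim)
  moreover have "(\<lambda>k. gave_deriv A B (f k) (d k)) \<longlonglongrightarrow> - gave_map A B b p + c' *\<^sub>R (1, 0)"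
    using d p(2) by (simp only: newton_direction_iff) (intro tendsto_intros tendsto_gave_map p c)
  ultimately show ?thesis
    using d_lim LIMSEQ_unique by blast
qed

section \<open>Runs that never stop\<close>

locale nonstop_run =
  fixes A B :: "real^'n^'n" and b :: "real^'n"
    and \<theta> \<delta> \<gamma> :: real
    and z :: "nat \<Rightarrow> real \<times> (real^'n)" and C \<beta> :: "nat \<Rightarrow> real"
  assumes run: "NSNA_run A B b \<theta> \<delta> \<gamma> z C \<beta>"
    and residual_nonzero: "norm (gave_map A B b (z k)) \<noteq> 0"
begin

abbreviation "H \<equiv> gave_map A B b"
abbreviation "Q \<equiv> merit A B b"
abbreviation "\<mu> k \<equiv> fst (z k)"

lemma params: "0 < \<theta>" "\<theta> < 1" "0 < \<delta>" "\<delta> < 1" "0 < \<gamma>" "\<gamma> < 1" "\<gamma> * \<mu> 0 < 1"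
  using run by (auto simp: NSNA_run_def)

lemma step: "NSNA_step A B b \<theta> \<delta> \<gamma> (z k) (C k) (\<beta> k) (z (Suc k)) (C (Suc k)) (\<beta> (Suc k))"
  using run residual_nonzero by (auto simp: NSNA_run_def)

lemma C_Suc: "C (Suc k) = (C k + 1) * Q (z (Suc k)) / (Q (z (Suc k)) + 1)"
  using step by (auto simp: NSNA_step_def)

lemma \<beta>_eq: "\<beta> k = \<gamma> * C k"
  using run step by (cases k) (auto simp: NSNA_run_def NSNA_step_def)

lemma merit_pos: "Q (z k) > 0"
  using residual_nonzero[of k] by (simp add: merit_def)

text \<open>When \<open>a < 1\<close>, the maximality of \<open>a\<close> means that the previous trial value \<open>a / \<delta>\<close> was rejected.\<close>

definition step_data :: "nat \<Rightarrow> real \<times> (real^'n) \<Rightarrow> real \<Rightarrow> bool" where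
  "step_data k d a \<longleftrightarrow>
     newton_direction A B b (\<beta> k) (z k) d \<and> z (Suc k) = z k + a *\<^sub>R d \<and> 0 < a \<and> a \<le> 1 \<and>
     (Q (z (Suc k)) \<le> \<theta>\<^sup>2 * Q (z k) \<or>
      Q (z (Suc k)) \<le> C k - \<gamma> * (norm (a *\<^sub>R d))\<^sup>2 \<and>
      (a < 1 \<longrightarrow> a / \<delta> \<le> 1 \<and>
         C k - \<gamma> * (norm ((a / \<delta>) *\<^sub>R d))\<^sup>2 < Q (z k + (a / \<delta>) *\<^sub>R d)))"

lemma ex_step_data: "\<exists>d a. step_data k d a"
proof -
  let ?V = "line_search_values A B b \<delta> \<gamma> (C k) (z k)"
  obtain d where d: "newton_direction A B b (\<beta> k) (z k) d"
    and alt: "if norm (H (z k + d)) \<le> \<theta> * norm (H (z k)) then z (Suc k) = z k + d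
      else (\<exists>\<alpha>\<in>?V d. (\<forall>a\<in>?V d. a \<le> \<alpha>) \<and> z (Suc k) = z k + \<alpha> *\<^sub>R d)"
    using step[of k] unfolding NSNA_step_def by blast
  show ?thesis
  proof (cases "norm (H (z k + d)) \<le> \<theta> * norm (H (z k))")
    case True
    then have "(norm (H (z k + d)))\<^sup>2 \<le> (\<theta> * norm (H (z k)))\<^sup>2"
      by (intro power_mono) auto
    then have "step_data k d 1"
      using True alt d by (auto simp: step_data_def merit_def power_mult_distrib)
    then show ?thesis by blast
  next
    case False
    with alt obtain a where a: "a \<in> ?V d" "\<And>a'. a' \<in> ?V d \<Longrightarrow> a' \<le> a" "z (Suc k) = z k + a *\<^sub>R d"
      by auto
    obtain m where m: "a = \<delta> ^ m"
      using a(1) by (auto simp: line_search_values_def)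
    have a01: "0 < a" "a \<le> 1"
      unfolding m using params by (auto intro: power_le_one)
    have "a / \<delta> \<le> 1 \<and> C k - \<gamma> * (norm ((a / \<delta>) *\<^sub>R d))\<^sup>2 < Q (z k + (a / \<delta>) *\<^sub>R d)"
      if less: "a < 1"
    proof -
      \<comment> \<open>Exponent 0 would give \<open>a = 1\<close>, so \<open>a / \<delta>\<close>
        is itself a power of \<open>\<delta>\<close> and hence a trial value.\<close>
      obtain m' where m': "m = Suc m'"
        using less m by (cases m) auto
      have eq: "a / \<delta> = \<delta> ^ m'"
        using params by (simp add: m m')
      have "a < a / \<delta>"
        using a01 params by (simp add: less_divide_eq)
      then have "a / \<delta> \<notin> ?V d"
        using a(2) by force
      then show ?thesis
        unfolding line_search_values_def eq using params by (auto simp: not_le intro: power_le_one)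
    qed
    then have "step_data k d a"
      using a a01 d by (auto simp: step_data_def line_search_values_def)
    then show ?thesis by blast
  qed
qed

section \<open>Invariants of the iteration\<close>

lemma merit_Suc_le:
  assumes "step_data k d a" "Q (z k) \<le> C k"
  shows "Q (z (Suc k)) \<le> C k"
proof -
  have "\<theta>\<^sup>2 * Q (z k) \<le> 1 * Q (z k)"
    using params merit_pos[of k] by (intro mult_right_mono) (auto simp: power_le_one)
  moreover have "0 \<le> \<gamma> * (norm (a *\<^sub>R d))\<^sup>2"
    using params by simp
  ultimately show ?thesis
    using assms unfolding step_data_def by linarith
qed

text \<open>With \<open>q = Q (z (Suc k))\<close>, the update gives
  \<open>C (Suc k) - q = q * (C k - q) / (q + 1)\<close>, which is nonnegative once
  \<open>q \<le> C k\<close>.\<close>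

lemma merit_le_C: "Q (z k) \<le> C k"
proof (induction k)
  case 0
  then show ?case using run by (simp add: NSNA_run_def)
next
  case (Suc k)
  obtain d a where "step_data k d a" using ex_step_data by blast
  from merit_Suc_le[OF this Suc] have "Q (z (Suc k)) \<le> C k" .
  with merit_pos[of "Suc k"] show ?case
    by (simp add: C_Suc le_divide_eq mult.commute mult_left_mono)
qed

lemma merit_Suc_le_C: "Q (z (Suc k)) \<le> C k"
  using ex_step_data merit_Suc_le merit_le_C by blast

lemma C_pos: "C k > 0"
  using merit_pos[of k] merit_le_C[of k] by linarith

text \<open>With \<open>q = Q (z (Suc k))\<close>, the decrease is
  \<open>(C k - q) / (q + 1)\<close>.\<close>

lemma C_Suc_le: "C (Suc k) \<le> C k"
  using merit_pos[of "Suc k"] merit_Suc_le_C[of k]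
  by (simp add: C_Suc divide_le_eq algebra_simps)

lemma \<beta>_pos: "\<beta> k > 0"
  using C_pos[of k] params by (simp add: \<beta>_eq)

lemma fst_step:
  assumes "newton_direction A B b (\<beta> k) (z k) d" "\<mu> k > 0"
  shows "fst (z k + s *\<^sub>R d) = \<mu> k - s * (\<mu> k - \<beta> k)"
  by (simp add: newton_direction_fst[OF assms] algebra_simps)

text \<open>A step of length at most 1 does not carry \<open>\<mu> k\<close> past its target
  \<open>\<beta> k\<close>. Thus the smoothing parameter stays positive on the whole trial
  segment.\<close>

lemma fst_step_ge:
  assumes "newton_direction A B b (\<beta> k) (z k) d" "\<beta> k \<le> \<mu> k" "s \<le> 1"
  shows "fst (z k + s *\<^sub>R d) \<ge> \<beta> k"
proof -
  have "s * (\<mu> k - \<beta> k) \<le> 1 * (\<mu> k - \<beta> k)"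
    using assms by (intro mult_right_mono) auto
  then show ?thesis
    using fst_step[OF assms(1)] assms(2) \<beta>_pos[of k] by simp
qed

text \<open>The new parameter stays above the old \<open>\<beta> k\<close>, and
  \<open>\<beta>\<close> decreases with \<open>C\<close>.\<close>

lemma \<beta>_le_\<mu>: "\<beta> k \<le> \<mu> k"
proof (induction k)
  case 0
  then show ?case using run unfolding NSNA_run_def by linarith
next
  case (Suc k)
  obtain d a where "step_data k d a" using ex_step_data by blast
  then have "\<beta> k \<le> \<mu> (Suc k)"
    using fst_step_ge[OF _ Suc] by (simp add: step_data_def)
  moreover have "\<beta> (Suc k) \<le> \<beta> k"
    using C_Suc_le[of k] params by (simp add: \<beta>_eq)
  ultimately show ?case by simp
qed

lemma \<mu>_pos: "\<mu> k > 0"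
  using \<beta>_pos[of k] \<beta>_le_\<mu>[of k] by linarith

lemma \<mu>_le: "\<mu> k \<le> \<mu> 0"
proof (induction k)
  case (Suc k)
  obtain d a where "step_data k d a" using ex_step_data by blast
  then have "\<mu> (Suc k) = \<mu> k - a * (\<mu> k - \<beta> k)" "0 < a"
    using fst_step[OF _ \<mu>_pos, of k d a] by (auto simp: step_data_def)
  moreover from this have "0 \<le> a * (\<mu> k - \<beta> k)"
    using \<beta>_le_\<mu>[of k] by simp
  ultimately show ?case using Suc by linarith
qed simp

section \<open>The residual at accumulation points\<close>

lemma residual_zero_at_accumulation_point:
  assumes W: "column_W_property (A + B) (A - B)"
    and r: "strict_mono r" and lim: "(z \<circ> r) \<longlonglongrightarrow> p"
  shows "H p = 0"
proof -
  have sub: "(\<lambda>k. X (r k)) \<longlonglongrightarrow> L" if "X \<longlonglongrightarrow> L" for X :: "nat \<Rightarrow> real" and L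
    using LIMSEQ_subseq_LIMSEQ[OF that r] by (simp add: o_def)
  have z_lim: "(\<lambda>k. z (r k)) \<longlonglongrightarrow> p"
    using lim by (simp add: o_def)
  have "decseq C"
    by (rule decseq_SucI) (rule C_Suc_le)
  moreover have "0 \<le> C k" for k
    using C_pos[of k] by simp
  ultimately obtain c where c: "C \<longlonglongrightarrow> c" "\<And>k. c \<le> C k"
    using decseq_convergent by metis
  have "c \<ge> 0"
    using c(1) by (rule LIMSEQ_le_const) (auto intro: less_imp_le C_pos)
  have C_Suc_lim: "(\<lambda>k. C (Suc k)) \<longlonglongrightarrow> c"
    using c(1) by (rule LIMSEQ_Suc)
  \<comment> \<open>Solving the update of \<open>C\<close> for the merit value leaves a denominator
    that tends to 1, so convergence of \<open>C\<close> carries over.\<close>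
  have Q_eq: "Q (z (Suc k)) = C (Suc k) / (C k + 1 - C (Suc k))" for k
  proof -
    have "C (Suc k) * (Q (z (Suc k)) + 1) = (C k + 1) * Q (z (Suc k))"
      using merit_pos[of "Suc k"] by (simp add: C_Suc)
    with C_Suc_le[of k] show ?thesis
      by (simp add: eq_divide_eq algebra_simps)
  qed
  have "(\<lambda>k. Q (z (Suc k))) \<longlonglongrightarrow> c / (c + 1 - c)"
    unfolding Q_eq by (intro tendsto_intros c C_Suc_lim) simp
  then have Q_Suc_lim: "(\<lambda>k. Q (z (Suc k))) \<longlonglongrightarrow> c"
    by simp
  then have Q_lim: "(\<lambda>k. Q (z k)) \<longlonglongrightarrow> c"
    by (rule LIMSEQ_imp_Suc)
  have Qp: "Q p = c"
    using LIMSEQ_unique[OF tendsto_merit[OF z_lim] sub[OF Q_lim]] .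
  have "c = 0"
  proof (rule ccontr)
    assume "c \<noteq> 0"
    with \<open>c \<ge> 0\<close> have c_pos: "c > 0" by simp
    obtain d a where da: "\<And>k. step_data k (d k) (a k)"
      using ex_step_data by metis
    then have newton: "newton_direction A B b (\<beta> k) (z k) (d k)"
      and a01: "0 < a k" "a k \<le> 1" for k
      by (auto simp: step_data_def)
    have \<beta>_lim: "\<beta> \<longlonglongrightarrow> \<gamma> * c"
      unfolding \<beta>_eq by (intro tendsto_intros c)
    have p_lim: "(\<lambda>k. \<mu> (r k)) \<longlonglongrightarrow> fst p"
      by (intro tendsto_intros z_lim)
    have "\<gamma> * c \<le> fst p"
      using sub[OF \<beta>_lim] p_lim by (rule LIMSEQ_le) (auto intro: \<beta>_le_\<mu>)
    moreover have "\<gamma> * c > 0"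
      using c_pos params by simp
    ultimately have p_pos: "fst p > 0"
      by linarith
    have "fst p \<le> \<mu> 0"
      using p_lim by (rule LIMSEQ_le_const2) (auto intro: \<mu>_le)
    then have \<gamma>p: "\<gamma> * fst p < 1"
      using params mult_left_mono[of "fst p" "\<mu> 0" \<gamma>] by linarith
    obtain v where v: "(\<lambda>k. d (r k)) \<longlonglongrightarrow> v"
      and newton_v: "gave_deriv A B p v = - H p + (\<gamma> * c) *\<^sub>R (1, 0)"
      using newton_directions_converge[OF W p_pos \<mu>_pos z_lim sub[OF \<beta>_lim] newton] by blast

    \<comment> \<open>The limit \<open>(1 - \<theta>\<^sup>2) * c\<close> is positive, which
      eventually excludes the first alternative in \<open>step_data\<close>.\<close>
    have "(\<lambda>k. Q (z (Suc k)) - \<theta>\<^sup>2 * Q (z k)) \<longlonglongrightarrow> c - \<theta>\<^sup>2 * c"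
      by (intro tendsto_intros Q_Suc_lim Q_lim)
    moreover have "\<theta>\<^sup>2 * c < 1 * c"
      using params c_pos by (intro mult_strict_right_mono) (auto simp: power_less_one_iff)
    ultimately have "\<forall>\<^sub>F k in sequentially. 0 < Q (z (Suc k)) - \<theta>\<^sup>2 * Q (z k)"
      by (intro order_tendstoD) auto
    then have search: "\<forall>\<^sub>F k in sequentially.
        Q (z (Suc k)) \<le> C k - \<gamma> * (norm (a k *\<^sub>R d k))\<^sup>2 \<and>
        (a k < 1 \<longrightarrow> a k / \<delta> \<le> 1 \<and>
           C k - \<gamma> * (norm ((a k / \<delta>) *\<^sub>R d k))\<^sup>2 < Q (z k + (a k / \<delta>) *\<^sub>R d k))"
    proof (rule eventually_mono)
      fix k assume "0 < Q (z (Suc k)) - \<theta>\<^sup>2 * Q (z k)"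
      with da[of k] show "Q (z (Suc k)) \<le> C k - \<gamma> * (norm (a k *\<^sub>R d k))\<^sup>2 \<and>
        (a k < 1 \<longrightarrow> a k / \<delta> \<le> 1 \<and>
           C k - \<gamma> * (norm ((a k / \<delta>) *\<^sub>R d k))\<^sup>2 < Q (z k + (a k / \<delta>) *\<^sub>R d k))"
        unfolding step_data_def by linarith
    qed

    \<comment> \<open>Accepted line searches bound this by the gap
      \<open>C k - Q (z (Suc k))\<close> over \<open>\<gamma>\<close>, and both sequences in the gap
      tend to \<open>c\<close>.\<close>
    have "(\<lambda>k. (norm (a k *\<^sub>R d k))\<^sup>2) \<longlonglongrightarrow> 0"
    proof (rule tendsto_sandwich[OF _ _ tendsto_const])
      show "(\<lambda>k. (C k - Q (z (Suc k))) / \<gamma>) \<longlonglongrightarrow> 0"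
        using tendsto_divide[OF tendsto_diff[OF c(1) Q_Suc_lim] tendsto_const, of \<gamma>] params by simp
      show "\<forall>\<^sub>F k in sequentially. (norm (a k *\<^sub>R d k))\<^sup>2 \<le> (C k - Q (z (Suc k))) / \<gamma>"
        using search by (rule eventually_mono) (use params in \<open>simp add: le_divide_eq mult.commute\<close>)
    qed simp
    then have "(\<lambda>k. sqrt ((norm (a k *\<^sub>R d k))\<^sup>2)) \<longlonglongrightarrow> sqrt 0"
      by (rule tendsto_real_sqrt)
    then have ad_lim: "(\<lambda>k. a k * norm (d k)) \<longlonglongrightarrow> 0"
      using a01 by (simp add: abs_of_pos tendsto_rabs_zero_iff)

    have "v \<noteq> 0"
    proof
      assume "v = 0"
      then have "H p = (\<gamma> * c) *\<^sub>R (1, 0)"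
        using newton_v linear_0[OF has_derivative_linear[OF has_derivative_gave_map[OF p_pos]]]
        by (simp add: add_eq_0_iff)
      \<comment> \<open>The first component and the squared norm of the same identity; cancelling
        \<open>c\<close> in the second gives \<open>\<gamma>\<^sup>2 * c = 1\<close>.\<close>
      then have "fst p = \<gamma> * c" "c = (\<gamma> * c)\<^sup>2"
        using Qp by (auto simp: gave_map_def merit_def prod_eq_iff norm_Pair)
      then have "\<gamma> * fst p = 1"
        using c_pos by (simp add: power2_eq_square)
      with \<gamma>p show False by simp
    qed
    then have "(\<lambda>k. a (r k) * norm (d (r k)) / norm (d (r k))) \<longlonglongrightarrow> 0 / norm v"
      by (intro tendsto_divide sub[OF ad_lim] tendsto_norm v) auto
    moreover have "\<forall>\<^sub>F k in sequentially. d (r k) \<noteq> 0"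
      using tendsto_imp_eventually_ne[OF v \<open>v \<noteq> 0\<close>] .
    ultimately have a_lim: "(\<lambda>k. a (r k)) \<longlonglongrightarrow> 0"
      by (auto elim!: Lim_transform_eventually eventually_mono)

    \<comment> \<open>Whenever \<open>a (r k) < 1\<close> and the line search was used, this is the
      last rejected step length.\<close>
    define t where "t k = a (r k) / \<delta>" for k
    have t_lim: "t \<longlonglongrightarrow> 0"
      unfolding t_def using tendsto_divide[OF a_lim tendsto_const, of \<delta>] params by simp
    have t_pos: "t k > 0" for k
      using a01 params by (simp add: t_def)
    define G where "G k s = 2 * (H (z (r k) + s *\<^sub>R d (r k)) \<bullet>
      gave_deriv A B (z (r k) + s *\<^sub>R d (r k)) (d (r k)))" for k s
    \<comment> \<open>The bound \<open>t k \<le> 1\<close> keeps the segment where the merit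
      function is differentiable.\<close>
    have mean: "\<exists>s. 0 < s \<and> s < t k \<and>
        Q (z (r k) + t k *\<^sub>R d (r k)) - Q (z (r k)) = t k * G k s" if "t k \<le> 1" for k
    proof -
      have "\<exists>s>0. s < t k \<and> Q (z (r k) + t k *\<^sub>R d (r k)) - Q (z (r k) + 0 *\<^sub>R d (r k)) = (t k - 0) * G k s"
      proof (rule MVT2[OF t_pos])
        fix s assume "0 \<le> s" "s \<le> t k"
        then have "fst (z (r k) + s *\<^sub>R d (r k)) > 0"
          using fst_step_ge[OF newton \<beta>_le_\<mu>, of s "r k"] \<beta>_pos[of "r k"] that by linarith
        then show "((\<lambda>s. Q (z (r k) + s *\<^sub>R d (r k))) has_real_derivative G k s) (at s)"
          unfolding G_def by (rule has_real_derivative_merit_along_line)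
      qed
      then show ?thesis by auto
    qed
    then obtain s where s: "\<And>k. t k \<le> 1 \<Longrightarrow> 0 < s k \<and> s k < t k \<and>
        Q (z (r k) + t k *\<^sub>R d (r k)) - Q (z (r k)) = t k * G k (s k)"
      by metis
    have "\<forall>\<^sub>F k in sequentially. a (r k) < 1"
      using order_tendstoD(2)[OF a_lim] by simp
    moreover have "\<forall>\<^sub>F k in sequentially. a (r k) < 1 \<longrightarrow> t k \<le> 1 \<and>
        C (r k) - \<gamma> * (norm (t k *\<^sub>R d (r k)))\<^sup>2 < Q (z (r k) + t k *\<^sub>R d (r k))"
      using eventually_subseq[OF r search] unfolding t_def by (rule eventually_mono) blast
    ultimately have rejected: "\<forall>\<^sub>F k in sequentially. t k \<le> 1 \<and>
        C (r k) - \<gamma> * (norm (t k *\<^sub>R d (r k)))\<^sup>2 < Q (z (r k) + t k *\<^sub>R d (r k))"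
      by eventually_elim blast
    have s_lim: "s \<longlonglongrightarrow> 0"
    proof (rule tendsto_sandwich[OF _ _ tendsto_const t_lim])
      show "\<forall>\<^sub>F k in sequentially. 0 \<le> s k" "\<forall>\<^sub>F k in sequentially. s k \<le> t k"
        using rejected by (auto elim!: eventually_mono dest!: s)
    qed
    have "(\<lambda>k. z (r k) + s k *\<^sub>R d (r k)) \<longlonglongrightarrow> p + 0 *\<^sub>R v"
      by (intro tendsto_intros z_lim s_lim v)
    then have w_lim: "(\<lambda>k. z (r k) + s k *\<^sub>R d (r k)) \<longlonglongrightarrow> p"
      by simp
    have "(\<lambda>k. G k (s k)) \<longlonglongrightarrow> 2 * (H p \<bullet> gave_deriv A B p v)"
      unfolding G_def by (intro tendsto_intros tendsto_gave_map tendsto_gave_deriv w_lim v p_pos)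
    moreover have "(\<lambda>k. - \<gamma> * t k * (norm (d (r k)))\<^sup>2) \<longlonglongrightarrow> - \<gamma> * 0 * (norm v)\<^sup>2"
      by (intro tendsto_intros t_lim v)
    moreover have "\<forall>\<^sub>F k in sequentially. - \<gamma> * t k * (norm (d (r k)))\<^sup>2 \<le> G k (s k)"
      using rejected
    proof (rule eventually_mono)
      fix k assume k: "t k \<le> 1 \<and>
        C (r k) - \<gamma> * (norm (t k *\<^sub>R d (r k)))\<^sup>2 < Q (z (r k) + t k *\<^sub>R d (r k))"
      \<comment> \<open>Rejection compares with \<open>C (r k)\<close>; since
        \<open>Q (z (r k)) \<le> C (r k)\<close>, it also bounds the increment of \<open>Q\<close>
        from below. Dividing by \<open>t k\<close> leaves a lower bound that tends to 0.\<close>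
      with s[of k] merit_le_C[of "r k"]
      have "- \<gamma> * (norm (t k *\<^sub>R d (r k)))\<^sup>2 \<le> t k * G k (s k)"
        by linarith
      then have "t k * (- \<gamma> * t k * (norm (d (r k)))\<^sup>2) \<le> t k * G k (s k)"
        by (simp add: power_mult_distrib power2_eq_square algebra_simps)
      with t_pos[of k] show "- \<gamma> * t k * (norm (d (r k)))\<^sup>2 \<le> G k (s k)"
        by (metis mult_le_cancel_left_pos)
    qed
    ultimately have "- \<gamma> * 0 * (norm v)\<^sup>2 \<le> 2 * (H p \<bullet> gave_deriv A B p v)"
      using tendsto_le[OF sequentially_bot] by blast
    then have "0 \<le> H p \<bullet> gave_deriv A B p v"
      by simp
    also have "H p \<bullet> gave_deriv A B p v = \<gamma> * c * fst p - c"
    proof -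
      have "H p \<bullet> H p = c"
        using Qp by (simp add: merit_def power2_norm_eq_inner)
      moreover have "H p \<bullet> (1, 0) = fst p"
        by (simp add: inner_prod_def gave_map_def)
      ultimately show ?thesis
        by (simp only: newton_v inner_add_right inner_minus_right inner_scaleR_right)
    qed
    also have "\<dots> = (\<gamma> * fst p - 1) * c"
      by (simp add: algebra_simps)
    also have "\<dots> < 0"
      using \<gamma>p c_pos by (simp add: mult_neg_pos)
    finally show False by simp
  qed
  with Qp show ?thesis
    by (simp add: merit_def)
qed

end

theorem theorem4p1:
  fixes A B :: "real^'n^'n" and b :: "real^'n"
    and \<theta> \<delta> \<gamma> :: real
    and z :: "nat \<Rightarrow> real \<times> (real^'n)" and C \<beta> :: "nat \<Rightarrow> real"
    and zstar :: "real \<times> (real^'n)"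
  assumes "B \<noteq> 0"
    and "column_W_property (A + B) (A - B)"
    and "NSNA_run A B b \<theta> \<delta> \<gamma> z C \<beta>"
    and "\<And>k. norm (gave_map A B b (z k)) \<noteq> 0"
    and "accumulation_point z zstar"
  shows "gave_map A B b zstar = 0 \<and>
         fst zstar = 0 \<and> A *v snd zstar + B *v \<bar>snd zstar\<bar> - b = 0"
proof -
  interpret nonstop_run A B b \<theta> \<delta> \<gamma> z C \<beta>
    using assms(3,4) by unfold_locales
  obtain r where "strict_mono r" "(z \<circ> r) \<longlonglongrightarrow> zstar"
    using assms(5) by (auto simp: accumulation_point_def)
  from residual_zero_at_accumulation_point[OF assms(2) this]
  have zero: "gave_map A B b zstar = 0" .
  then have "fst zstar = 0"
    by (simp add: gave_map_def prod_eq_iff)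
  \<comment> \<open>At parameter 0 the smoothing is exact: \<open>sqrt (t\<^sup>2)\<close> is the
    absolute value of \<open>t\<close>.\<close>
  moreover have "smooth_abs_vec 0 x = \<bar>x\<bar>" for x :: "real^'n"
    by (simp add: smooth_abs_vec_def smooth_abs_def abs_vec_def)
  ultimately show ?thesis
    using zero by (simp add: gave_map_def prod_eq_iff)
qed

end
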